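(* Let $0<q<1$ and $\alpha>-1$. For every $n\in\mathbb{N}_0$ and every $z\in\mathbb{C}$, the generalized $q$-Bernoulli polynomial $B^{(3)}_{n,\alpha}(z;q)$ satisfies $$B^{(3)}_{n,\alpha}(z;q)=(-1)^n\det A_n,$$ where $A_n=(a_{ij})_{i,j=0}^{n}$ is the $(n+1)\times(n+1)$ matrix whose entries are, for $j\in\{0,1,\dots,n\}$, $$a_{0j}=q^{\frac{j(j-1)}{4}}z^j,\qquad a_{ij}=\begin{bmatrix} j\\ i-1\end{bmatrix}_q\mu_{j-i+1,\alpha}(q)\quad(1\le i\le n),$$ (with $a_{ij}=0$ when $i-1>j$), where for $m\in\mathbb{N}_0$ $$\mu_{m,\alpha}(q)=\frac{(-1)^m[m]_q!}{2^m}\sum_{k=0}^{\lfloor m/2\rfloor}\frac{q^{k(k+\frac12)}(1-q)^{2k}\,c_{m-2k}}{(q^2;q^2)_k\,(q^{2\alpha+2};q^2)_k},$$ and $c_0=1$ and, for $n\ge1$, $$c_n=\sum_{k=1}^{n}(-1)^k\sum_{\substack{s_1+\cdots+s_k=n\\ s_i>0\ (i=1,\dots,k)}}\frac{q^{\sum_{i=1}^k s_i(s_i-1)/4}}{[s_1]_q!\,[s_2]_q!\cdots[s_k]_q!}.$$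
   Context: Notation: $(a;q)_n=\prod_{k=0}^{n-1}(1-aq^k)$ and $(a;q)_0=1$; $[n]_q=\frac{1-q^n}{1-q}$; $[n]_q!=\prod_{k=1}^n[k]_q$; $\begin{bmatrix} n\\ k\end{bmatrix}_q=\frac{(q;q)_n}{(q;q)_k(q;q)_{n-k}}$ for $0\le k\le n$, and $\begin{bmatrix} n\\ k\end{bmatrix}_q=0$ for $k>n\ge 0$. $\mathbb{N}_0=\{0,1,2,\dots\}$. The sum over $s_1,\dots,s_k$ runs over tuples of positive integers. The $q$-exponential is $\exp_q(z)=\sum_{n\ge0}q^{n(n-1)/4}\frac{z^n}{[n]_q!}$ for $z\in\mathbb{C}$. The function $g^{(3)}_\alpha$ (a normalized third Jackson $q$-Bessel function with base $q^2$) is the entire function $$g^{(3)}_\alpha(t;q)=\sum_{n=0}^\infty\frac{(-1)^n\,q^{n(n+1)}\,\left(\tfrac t2(1-q)q^{-1/4}\right)^{2n}}{(q^2;q^2)_n(q^{2\alpha+2};q^2)_n}.$$ The polynomials $B^{(3)}_{n,\alpha}(z;q)$ are defined by the generating function (for $|t|$ sufficiently small) $$\frac{\exp_q(zt)\,\exp_q(-t/2)}{g^{(3)}_\alpha(it;q)}=\sum_{n=0}^\infty B^{(3)}_{n,\alpha}(z;q)\frac{t^n}{[n]_q!}.$$ *)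

theory Defs
  imports
    "HOL-Analysis.FPS_Convergence"
    "Jordan_Normal_Form.Determinant"
begin

definition qpoch :: "real \<Rightarrow> real \<Rightarrow> nat \<Rightarrow> real" where
  "qpoch a q n = (\<Prod>k<n. 1 - a * q ^ k)"

definition qint :: "real \<Rightarrow> nat \<Rightarrow> real" where
  "qint q n = (1 - q ^ n) / (1 - q)"

definition qfact :: "real \<Rightarrow> nat \<Rightarrow> real" where
  "qfact q n = (\<Prod>k=1..n. qint q k)"

definition qbinom :: "real \<Rightarrow> nat \<Rightarrow> nat \<Rightarrow> real" where
  "qbinom q n k = (if k \<le> n then qpoch q q n / (qpoch q q k * qpoch q q (n - k)) else 0)"

definition exp_q :: "real \<Rightarrow> complex \<Rightarrow> complex" where
  "exp_q q z = (\<Sum>n. of_real (q powr (real n * (real n - 1) / 4)) * z ^ n / of_real (qfact q n))"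

definition g3 :: "real \<Rightarrow> real \<Rightarrow> complex \<Rightarrow> complex" where
  "g3 q \<alpha> t = (\<Sum>n. (-1) ^ n * of_real (q ^ (n * (n + 1))) *
       (t / 2 * of_real ((1 - q) * q powr (-1 / 4))) ^ (2 * n) /
       of_real (qpoch (q\<^sup>2) (q\<^sup>2) n * qpoch (q powr (2 * \<alpha> + 2)) (q\<^sup>2) n))"

definition bern3_gf :: "real \<Rightarrow> real \<Rightarrow> complex \<Rightarrow> complex \<Rightarrow> complex" where
  "bern3_gf q \<alpha> z t = exp_q q (z * t) * exp_q q (- t / 2) / g3 q \<alpha> (\<i> * t)"

definition is_bern3_seq :: "real \<Rightarrow> real \<Rightarrow> complex \<Rightarrow> (nat \<Rightarrow> complex) \<Rightarrow> bool" where
  "is_bern3_seq q \<alpha> z b \<longleftrightarrow>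
     (\<forall>\<^sub>F t in nhds 0. (\<lambda>n. b n * (t ^ n / of_real (qfact q n))) sums bern3_gf q \<alpha> z t)"

text \<open>For \<open>0 < q < 1\<close> and \<open>\<alpha> > -1\<close>, the defining sequence exists and is unique; see
  \<open>is_bern3_seq_bern3\<close> and \<open>is_bern3_seq_unique\<close> below.\<close>

definition bern3 :: "real \<Rightarrow> real \<Rightarrow> nat \<Rightarrow> complex \<Rightarrow> complex" where
  "bern3 q \<alpha> n z = (THE b. is_bern3_seq q \<alpha> z b) n"

definition pos_compositions :: "nat \<Rightarrow> nat \<Rightarrow> nat list set" where
  "pos_compositions n k = {s. length s = k \<and> sum_list s = n \<and> (\<forall>x\<in>set s. 0 < x)}"

definition c_coeff :: "real \<Rightarrow> nat \<Rightarrow> real" where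
  "c_coeff q n = (if n = 0 then 1 else
     (\<Sum>k=1..n. (-1) ^ k * (\<Sum>s\<in>pos_compositions n k.
        q powr (\<Sum>i<k. real (s ! i) * (real (s ! i) - 1) / 4) / (\<Prod>i<k. qfact q (s ! i)))))"

definition mu :: "real \<Rightarrow> real \<Rightarrow> nat \<Rightarrow> real" where
  "mu q \<alpha> m = (-1) ^ m * qfact q m / 2 ^ m *
     (\<Sum>k=0..m div 2. q powr (real k * (real k + 1 / 2)) * (1 - q) ^ (2 * k) * c_coeff q (m - 2 * k) /
        (qpoch (q\<^sup>2) (q\<^sup>2) k * qpoch (q powr (2 * \<alpha> + 2)) (q\<^sup>2) k))"

lemma finite_pos_compositions: "finite (pos_compositions n k)"
proof (rule finite_subset)
  show "pos_compositions n k \<subseteq> {s. set s \<subseteq> {..n} \<and> length s = k}"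
    by (auto simp: pos_compositions_def intro: member_le_sum_list)
qed (simp add: finite_lists_length_eq)

lemma qint_ge_1:
  assumes "0 < q" "q < 1" "1 \<le> k"
  shows "1 \<le> qint q k"
proof -
  have "q ^ k \<le> q ^ 1"
    using assms by (intro power_decreasing) auto
  then show ?thesis
    using assms by (simp add: qint_def field_simps)
qed

lemma qfact_ge_1: "0 < q \<Longrightarrow> q < 1 \<Longrightarrow> 1 \<le> qfact q n"
  unfolding qfact_def by (intro prod_ge_1) (auto intro: qint_ge_1)

lemma qfact_nonzero: "0 < q \<Longrightarrow> q < 1 \<Longrightarrow> qfact q n \<noteq> 0"
  using qfact_ge_1[of q n] by linarith

lemma qpoch_ge:
  assumes "0 < q" "q < 1" "0 < a" "a < 1"
  shows "(1 - a) ^ n \<le> qpoch a q n"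
proof -
  have "(\<Prod>k<n. 1 - a) \<le> (\<Prod>k<n. 1 - a * q ^ k)"
  proof (intro prod_mono conjI)
    fix k
    have "a * q ^ k \<le> a * 1"
      using assms by (intro mult_left_mono power_le_one) auto
    then show "1 - a \<le> 1 - a * q ^ k" by simp
  qed (use assms in auto)
  then show ?thesis by (simp add: qpoch_def)
qed

lemma power_series_has_fps_expansion:
  fixes a :: "nat \<Rightarrow> complex"
  assumes "C > 0" and "\<And>n. norm (a n) \<le> C ^ n"
  shows "(\<lambda>t. \<Sum>n. a n * t ^ n) has_fps_expansion Abs_fps a"
proof -
  let ?z = "of_real (1 / (2 * C)) :: complex"
  have "summable (\<lambda>n. a n * ?z ^ n)"
  proof (rule summable_comparison_test)
    show "\<exists>N. \<forall>n\<ge>N. norm (a n * ?z ^ n) \<le> (1 / 2) ^ n"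
    proof (intro exI allI impI)
      fix n
      have "norm (a n * ?z ^ n) = norm (a n) * (1 / (2 * C)) ^ n"
        using assms(1) by (simp add: norm_mult norm_power norm_divide)
      also have "\<dots> \<le> C ^ n * (1 / (2 * C)) ^ n"
        using assms by (intro mult_right_mono) auto
      also have "\<dots> = (C * (1 / (2 * C))) ^ n"
        by (rule power_mult_distrib [symmetric])
      also have "C * (1 / (2 * C)) = 1 / 2"
        using assms(1) by simp
      finally show "norm (a n * ?z ^ n) \<le> (1 / 2) ^ n" .
    qed
  qed (simp add: summable_geometric)
  then have "ereal (norm ?z) \<le> conv_radius a"
    by (rule conv_radius_geI)
  moreover have "0 < ereal (norm ?z)" using assms(1) by simp
  ultimately have "0 < conv_radius a" by (rule less_le_trans[rotated])
  then show ?thesis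
    by (simp add: has_fps_expansion_def fps_conv_radius_def eval_fps_def)
qed

lemma exp_q_has_fps_expansion:
  assumes "0 < q" "q < 1"
  shows "(\<lambda>t. exp_q q (c * t)) has_fps_expansion
    Abs_fps (\<lambda>n. of_real (q powr (real n * (real n - 1) / 4)) * c ^ n / of_real (qfact q n))"
proof -
  let ?a = "\<lambda>n. of_real (q powr (real n * (real n - 1) / 4)) * c ^ n / of_real (qfact q n) :: complex"
  have "(\<lambda>t. \<Sum>n. ?a n * t ^ n) has_fps_expansion Abs_fps ?a"
  proof (rule power_series_has_fps_expansion)
    show "0 < norm c + 1" by (simp add: add_nonneg_pos)
    fix n
    have "q powr (real n * (real n - 1) / 4) \<le> 1"
      using assms by (intro powr_le1) (cases n; auto)+
    moreover have "1 \<le> qfact q n" using assms by (rule qfact_ge_1)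
    ultimately have "q powr (real n * (real n - 1) / 4) / qfact q n \<le> 1"
      by simp
    then have "q powr (real n * (real n - 1) / 4) / qfact q n * norm c ^ n \<le> 1 * norm c ^ n"
      by (intro mult_right_mono) auto
    also have "\<dots> \<le> (norm c + 1) ^ n"
      by (simp add: power_mono)
    finally show "norm (?a n) \<le> (norm c + 1) ^ n"
      using \<open>1 \<le> qfact q n\<close> by (simp add: norm_mult norm_divide norm_power)
  qed
  then show ?thesis
    by (simp add: exp_q_def power_mult_distrib field_simps)
qed

lemma g3_has_fps_expansion:
  assumes "0 < q" "q < 1" "\<alpha> > -1"
  shows "\<exists>G. (\<lambda>t. g3 q \<alpha> (\<i> * t)) has_fps_expansion G \<and> fps_nth G 0 = 1"
proof -
  define a where "a = q powr (2 * \<alpha> + 2)"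
  define r where "r = (1 - q) * q powr (-1 / 4) / 2"
  define D where "D n = qpoch (q\<^sup>2) (q\<^sup>2) n * qpoch a (q\<^sup>2) n" for n
  define d where "d = (1 - q\<^sup>2) * (1 - a)"
  define h where "h n = q ^ (n * (n + 1)) * r ^ (2 * n) / D n" for n
  define f where "f n = (if even n then h (n div 2) else 0)" for n
  have a: "0 < a" "a < 1"
    using assms powr_less_mono'[of q 0 "2 * \<alpha> + 2"] by (auto simp: a_def)
  have q2: "0 < q\<^sup>2" "q\<^sup>2 < 1"
    using assms by (auto simp: power_less_one_iff)
  have d: "0 < d" "d \<le> 1"
    using a q2 by (auto simp: d_def intro!: mult_le_one)
  have r: "0 < r" using assms by (simp add: r_def)
  have Dge: "d ^ n \<le> D n" for n
    unfolding d_def D_def power_mult_distrib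
    using a q2 by (intro mult_mono qpoch_ge) (auto intro!: order_trans[OF _ qpoch_ge])
  define C where "C = (r + 1) / d"
  have C: "0 < C" using d r by (simp add: C_def)
  have hb: "\<bar>h n\<bar> \<le> C ^ (2 * n)" for n
  proof -
    have dn: "0 < d ^ n" using d by simp
    have "d ^ (2 * n) \<le> d ^ n" using d by (intro power_decreasing) auto
    then have le: "d ^ (2 * n) \<le> D n" using Dge[of n] by linarith
    have "q ^ (n * (n + 1)) * r ^ (2 * n) \<le> 1 * (r + 1) ^ (2 * n)"
      using assms r by (intro mult_mono power_mono power_le_one) auto
    then have "h n \<le> (r + 1) ^ (2 * n) / d ^ (2 * n)"
      unfolding h_def using le d r assms by (intro frac_le) auto
    moreover have "0 \<le> h n"
      unfolding h_def using assms r dn Dge[of n] by (intro divide_nonneg_nonneg) auto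
    ultimately show ?thesis by (simp add: C_def power_divide)
  qed
  have "(\<lambda>t. \<Sum>n. of_real (f n) * t ^ n :: complex) has_fps_expansion Abs_fps (\<lambda>n. of_real (f n))"
  proof (rule power_series_has_fps_expansion[OF C])
    fix n
    show "norm (of_real (f n) :: complex) \<le> C ^ n"
      using hb[of "n div 2"] C by (auto simp: f_def)
  qed
  moreover have "g3 q \<alpha> (\<i> * t) = (\<Sum>n. of_real (f n) * t ^ n)" for t
  proof -
    have "(\<Sum>n. of_real (f n) * t ^ n) = (\<Sum>n. of_real (f (2 * n)) * t ^ (2 * n))"
      by (rule suminf_mono_reindex[symmetric, where g = "\<lambda>n. 2 * n"])
         (auto simp: strict_mono_def f_def elim!: evenE)
    also have "\<dots> = g3 q \<alpha> (\<i> * t)"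
      unfolding g3_def
    proof (intro arg_cong[where f = suminf] ext)
      fix n
      have "(\<i> * t / 2 * of_real ((1 - q) * q powr (-1 / 4))) ^ (2 * n) = (\<i> * (t * of_real r)) ^ (2 * n)"
        by (simp add: r_def mult_ac)
      also have "\<dots> = (-1) ^ n * (t ^ (2 * n) * of_real r ^ (2 * n))"
        by (simp only: power_mult_distrib) (simp add: power_mult)
      finally have eq: "(\<i> * t / 2 * of_real ((1 - q) * q powr (-1 / 4))) ^ (2 * n) =
          (-1) ^ n * (t ^ (2 * n) * of_real r ^ (2 * n))" .
      have sgn: "(-1) ^ n * ((-1) ^ n :: complex) = 1"
        by (simp flip: power_mult_distrib)
      show "of_real (f (2 * n)) * t ^ (2 * n) =
        (-1) ^ n * of_real (q ^ (n * (n + 1))) *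
       (\<i> * t / 2 * of_real ((1 - q) * q powr (-1 / 4))) ^ (2 * n) /
       of_real (qpoch (q\<^sup>2) (q\<^sup>2) n * qpoch (q powr (2 * \<alpha> + 2)) (q\<^sup>2) n)"
        unfolding eq using sgn
        by (simp add: f_def h_def D_def a_def)
    qed
    finally show ?thesis ..
  qed
  ultimately show ?thesis
    by (intro exI[of _ "Abs_fps (\<lambda>n. of_real (f n))"])
       (simp add: f_def h_def D_def qpoch_def)
qed

lemma bern3_gf_has_fps_expansion:
  assumes "0 < q" "q < 1" "\<alpha> > -1"
  shows "\<exists>F. bern3_gf q \<alpha> z has_fps_expansion F"
proof -
  obtain G where G: "(\<lambda>t. g3 q \<alpha> (\<i> * t)) has_fps_expansion G" "fps_nth G 0 = 1"
    using g3_has_fps_expansion[OF assms] by blast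
  have rI: "fps_conv_radius (inverse G) > 0"
    using G by (intro fps_conv_radius_inverse_pos) (auto simp: has_fps_expansion_def)
  have I: "eval_fps (inverse G) has_fps_expansion inverse G"
    using rI by (rule eval_fps_has_fps_expansion)
  have "(\<lambda>t. g3 q \<alpha> (\<i> * t) * eval_fps (inverse G) t) has_fps_expansion G * inverse G"
    using G(1) I by (rule has_fps_expansion_mult)
  moreover have "G * inverse G = 1"
    using inverse_mult_eq_1[of G] G(2) by (simp add: mult.commute)
  ultimately have ev: "\<forall>\<^sub>F t in nhds 0. g3 q \<alpha> (\<i> * t) * eval_fps (inverse G) t = 1"
    by (auto simp: has_fps_expansion_def elim: eventually_mono)
  obtain E1 where E1: "(\<lambda>t. exp_q q (z * t)) has_fps_expansion E1"
    using exp_q_has_fps_expansion[OF assms(1,2)] by blast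
  have "\<exists>E. (\<lambda>t. exp_q q ((-1/2) * t)) has_fps_expansion E"
    using exp_q_has_fps_expansion[OF assms(1,2)] by blast
  then obtain E2 where E2: "(\<lambda>t. exp_q q (- t / 2)) has_fps_expansion E2"
    by auto
  have P: "(\<lambda>t. exp_q q (z * t) * exp_q q (- t / 2) * eval_fps (inverse G) t)
     has_fps_expansion E1 * E2 * inverse G"
    by (intro has_fps_expansion_mult E1 E2 I)
  have "\<forall>\<^sub>F t in nhds 0. exp_q q (z * t) * exp_q q (- t / 2) * eval_fps (inverse G) t
      = bern3_gf q \<alpha> z t"
    using ev
  proof eventually_elim
    case (elim t)
    then have "eval_fps (inverse G) t = 1 / g3 q \<alpha> (\<i> * t)"
      by (metis mult_cancel_left nonzero_mult_div_cancel_left mult_zero_left zero_neq_one)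
    then show ?case by (simp add: bern3_gf_def)
  qed
  then have "bern3_gf q \<alpha> z has_fps_expansion E1 * E2 * inverse G"
    using P unfolding has_fps_expansion_def
    by (auto elim: eventually_elim2)
  then show ?thesis ..
qed

lemma is_bern3_seq_ex:
  assumes "0 < q" "q < 1" "\<alpha> > -1"
  shows "\<exists>b. is_bern3_seq q \<alpha> z b"
proof -
  obtain F where F: "bern3_gf q \<alpha> z has_fps_expansion F"
    using bern3_gf_has_fps_expansion[OF assms] by blast
  have "\<forall>\<^sub>F t in nhds 0. t \<in> eball 0 (fps_conv_radius F)"
    using F by (intro eventually_nhds_in_open) (auto simp: has_fps_expansion_def zero_ereal_def)
  moreover have "\<forall>\<^sub>F t in nhds 0. eval_fps F t = bern3_gf q \<alpha> z t"
    using F by (simp add: has_fps_expansion_def)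
  ultimately have "\<forall>\<^sub>F t in nhds 0. (\<lambda>n. fps_nth F n * t ^ n) sums bern3_gf q \<alpha> z t"
  proof eventually_elim
    case (elim t)
    then show ?case using sums_eval_fps[of t F] by simp
  qed
  then have "is_bern3_seq q \<alpha> z (\<lambda>n. fps_nth F n * of_real (qfact q n))"
    using assms by (simp add: is_bern3_seq_def qfact_nonzero)
  then show ?thesis by blast
qed

lemma is_bern3_seq_has_fps_expansion:
  assumes "is_bern3_seq q \<alpha> z b"
  shows "bern3_gf q \<alpha> z has_fps_expansion Abs_fps (\<lambda>n. b n / of_real (qfact q n))"
proof -
  let ?a = "\<lambda>n. b n / of_real (qfact q n)"
  have ev: "\<forall>\<^sub>F t in nhds 0. (\<lambda>n. ?a n * t ^ n) sums bern3_gf q \<alpha> z t"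
    using assms by (simp add: is_bern3_seq_def)
  then obtain e where e: "e > 0" "\<And>t. dist t 0 < e \<Longrightarrow> (\<lambda>n. ?a n * t ^ n) sums bern3_gf q \<alpha> z t"
    unfolding eventually_nhds_metric by blast
  have "summable (\<lambda>n. ?a n * of_real (e / 2) ^ n)"
    using e(2)[of "of_real (e / 2)"] e(1) by (auto simp: sums_iff)
  then have "ereal (norm (of_real (e / 2) :: complex)) \<le> conv_radius ?a"
    by (rule conv_radius_geI)
  moreover have "0 < ereal (norm (of_real (e / 2) :: complex))" using e(1) by simp
  ultimately have "0 < conv_radius ?a" by (rule less_le_trans[rotated])
  moreover have "\<forall>\<^sub>F t in nhds 0. (\<Sum>n. ?a n * t ^ n) = bern3_gf q \<alpha> z t"
    using ev by (rule eventually_mono) (simp add: sums_iff)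
  ultimately show ?thesis
    by (simp add: has_fps_expansion_def fps_conv_radius_def eval_fps_def)
qed

lemma is_bern3_seq_unique:
  assumes "0 < q" "q < 1" "is_bern3_seq q \<alpha> z b" "is_bern3_seq q \<alpha> z b'"
  shows "b = b'"
proof
  fix n
  have "b n / of_real (qfact q n) = b' n / of_real (qfact q n)"
    using fps_nth_fps_expansion[OF is_bern3_seq_has_fps_expansion[OF assms(3)], of n]
      fps_nth_fps_expansion[OF is_bern3_seq_has_fps_expansion[OF assms(4)], of n]
    by simp
  then show "b n = b' n" using qfact_nonzero[OF assms(1,2), of n] by simp
qed

lemma is_bern3_seq_bern3:
  assumes "0 < q" "q < 1" "\<alpha> > -1"
  shows "is_bern3_seq q \<alpha> z (\<lambda>n. bern3 q \<alpha> n z)"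
proof -
  have "is_bern3_seq q \<alpha> z (THE b. is_bern3_seq q \<alpha> z b)"
    using is_bern3_seq_ex[OF assms] is_bern3_seq_unique[OF assms(1,2)] by (metis theI)
  then show ?thesis by (simp add: bern3_def)
qed

end

theory Submission
  imports Defs
begin

text \<open>Writing \<open>\<mu>\<^sub>m\<close> for \<open>mu q \<alpha> m\<close>, the composition sum \<open>c\<^sub>n\<close> is the geometric series for
  \<open>1 / exp\<^sub>q(t)\<close>, so \<open>\<Sum> \<mu>\<^sub>m t\<^sup>m / [m]! = g(\<i>t) / exp\<^sub>q(-t/2)\<close>, and the generating function becomes
  \<open>exp\<^sub>q(zt) = (\<Sum> B\<^sub>n t\<^sup>n / [n]!) (\<Sum> \<mu>\<^sub>m t\<^sup>m / [m]!)\<close>. Comparing coefficients, the row \<open>0\<close> of \<open>A\<^sub>n\<close> is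
  \<open>(B\<^sub>0, \<dots>, B\<^sub>n)\<close> times the upper unitriangular matrix \<open>M\<close> with entry \<open>[j, k]\<^sub>q \<mu>\<^bsub>j-k\<^esub>\<close> at \<open>(k, j)\<close>,
  while its other rows are the first \<open>n\<close> rows of \<open>M\<close>. Thus \<open>A\<^sub>n = P M\<close> where \<open>P\<close> has row \<open>0\<close>
  equal to \<open>(B\<^sub>0, \<dots>, B\<^sub>n)\<close> above a shifted identity, and \<open>det P = (-1)\<^sup>n B\<^sub>n\<close>.\<close>

section \<open>\<open>q\<close>-factorials and Gaussian binomials\<close>

lemma qpoch_eq_qfact:
  assumes "q \<noteq> 1"
  shows "qpoch q q n = (1 - q) ^ n * qfact q n"
proof -
  have "qfact q n = (\<Prod>k<n. qint q (Suc k))"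
    unfolding qfact_def by (rule prod.reindex_bij_witness[of _ Suc "\<lambda>k. k - 1"]) auto
  also have "(1 - q) ^ n * \<dots> = (\<Prod>k<n. (1 - q) * qint q (Suc k))"
    by (simp add: prod.distrib)
  also have "\<dots> = qpoch q q n"
    using assms by (simp add: qpoch_def qint_def)
  finally show ?thesis ..
qed

lemma qbinom_eq_qfact:
  assumes "0 < q" "q < 1" "k \<le> n"
  shows "qbinom q n k = qfact q n / (qfact q k * qfact q (n - k))"
proof -
  have "(1 - q) ^ n = (1 - q) ^ k * (1 - q) ^ (n - k)"
    using assms by (simp flip: power_add)
  moreover have "(1 - q) ^ k \<noteq> 0" "(1 - q) ^ (n - k) \<noteq> 0"
    using assms by simp_all
  ultimately show ?thesis
    using assms by (simp add: qbinom_def qpoch_eq_qfact)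
qed

section \<open>Compositions and the reciprocal of the \<open>q\<close>-exponential\<close>

text \<open>The coefficient is a sum over all length-\<open>k\<close> lists with sum
  \<open>n\<close>. A list containing 0 contributes a zero factor, because \<open>U\<close> has no
  constant term, so only positive parts survive.\<close>

lemma fps_nth_power_pos_compositions:
  fixes U :: "real fps"
  assumes "fps_nth U 0 = 0" "0 < k"
  shows "fps_nth (U ^ k) n = (\<Sum>s\<in>pos_compositions n k. \<Prod>i<k. fps_nth U (s ! i))"
proof -
  have "fps_nth (U ^ k) n = (\<Sum>s\<in>natpermute n k. \<Prod>i<k. fps_nth U (s ! i))"
    using assms(2) by (cases k) (simp_all add: fps_power_nth_Suc lessThan_Suc_atMost atMost_atLeast0 del: power_Suc)
  also have "\<dots> = (\<Sum>s\<in>pos_compositions n k. \<Prod>i<k. fps_nth U (s ! i))"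
  proof (rule sum.mono_neutral_right)
    show "finite (natpermute n k)" by (rule natpermute_finite)
    show "pos_compositions n k \<subseteq> natpermute n k"
      by (auto simp: pos_compositions_def natpermute_def)
    show "\<forall>s\<in>natpermute n k - pos_compositions n k. (\<Prod>i<k. fps_nth U (s ! i)) = 0"
    proof
      fix s assume s: "s \<in> natpermute n k - pos_compositions n k"
      then have "0 \<in> set s" "length s = k"
        by (auto simp: pos_compositions_def natpermute_def)
      then obtain i where "i < k" "s ! i = 0" by (auto simp: in_set_conv_nth)
      then show "(\<Prod>i<k. fps_nth U (s ! i)) = 0"
        using assms(1) by (intro prod_zero) (auto intro!: bexI[of _ i])
    qed
  qed
  finally show ?thesis .
qed

definition exp_q_coeff :: "real \<Rightarrow> nat \<Rightarrow> real" where
  "exp_q_coeff q n = q powr (real n * (real n - 1) / 4) / qfact q n"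

lemma exp_q_coeff_0 [simp]: "0 < q \<Longrightarrow> exp_q_coeff q 0 = 1"
  by (simp add: exp_q_coeff_def qfact_def)

text \<open>The signed sum over compositions of length \<open>k\<close> is a coefficient of
  \<open>(1 - E) ^ k\<close>, where \<open>E\<close> is the \<open>q\<close>-exponential series.
  Powers with \<open>k > n\<close> start beyond degree \<open>n\<close>, so the cutoff
  \<open>N\<close> is free and one choice serves all degrees up to \<open>N\<close>.\<close>

lemma c_coeff_eq_sum_powers:
  assumes "0 < q" "n \<le> N"
  shows "c_coeff q n = fps_nth (\<Sum>k\<le>N. (1 - Abs_fps (exp_q_coeff q)) ^ k) n"
proof -
  let ?V = "1 - Abs_fps (exp_q_coeff q)"
  have V0: "fps_nth ?V 0 = 0"
    using assms by simp
  have pow: "fps_nth (?V ^ k) n = (-1) ^ k * (\<Sum>s\<in>pos_compositions n k.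
        q powr (\<Sum>i<k. real (s ! i) * (real (s ! i) - 1) / 4) / (\<Prod>i<k. qfact q (s ! i)))"
    if "0 < k" for k
  proof -
    have "fps_nth (?V ^ k) n = (\<Sum>s\<in>pos_compositions n k. \<Prod>i<k. fps_nth ?V (s ! i))"
      using V0 that by (rule fps_nth_power_pos_compositions)
    also have "\<dots> = (\<Sum>s\<in>pos_compositions n k. (-1) ^ k *
       (q powr (\<Sum>i<k. real (s ! i) * (real (s ! i) - 1) / 4) / (\<Prod>i<k. qfact q (s ! i))))"
    proof (rule sum.cong[OF refl])
      fix s assume s: "s \<in> pos_compositions n k"
      have "(\<Prod>i<k. fps_nth ?V (s ! i)) = (\<Prod>i<k. (-1) * exp_q_coeff q (s ! i))"
      proof (rule prod.cong[OF refl])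
        fix i assume "i \<in> {..<k}"
        then have "s ! i \<noteq> 0" using s by (auto simp: pos_compositions_def)
        then show "fps_nth ?V (s ! i) = (-1) * exp_q_coeff q (s ! i)" by simp
      qed
      also have "\<dots> = (-1) ^ k * (\<Prod>i<k. exp_q_coeff q (s ! i))"
        by (simp only: prod.distrib) simp
      also have "(\<Prod>i<k. exp_q_coeff q (s ! i)) =
          q powr (\<Sum>i<k. real (s ! i) * (real (s ! i) - 1) / 4) / (\<Prod>i<k. qfact q (s ! i))"
        using assms(1) by (simp add: exp_q_coeff_def prod_dividef powr_sum)
      finally show "(\<Prod>i<k. fps_nth ?V (s ! i)) = (-1) ^ k *
          (q powr (\<Sum>i<k. real (s ! i) * (real (s ! i) - 1) / 4) / (\<Prod>i<k. qfact q (s ! i)))" .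
    qed
    finally show ?thesis by (simp add: sum_distrib_left)
  qed
  have "fps_nth (\<Sum>k\<le>N. ?V ^ k) n = (\<Sum>k\<le>N. fps_nth (?V ^ k) n)"
    by (simp add: fps_sum_nth)
  also have "\<dots> = (\<Sum>k\<le>n. fps_nth (?V ^ k) n)"
    using assms(2) V0
    by (intro sum.mono_neutral_right) (auto intro!: startsby_zero_power_prefix[rule_format])
  also have "\<dots> = c_coeff q n"
  proof (cases "n = 0")
    case False
    \<comment> \<open>\<open>c_coeff\<close> sums from 1; the extra term \<open>k = 0\<close> is the
      coefficient of the constant series 1 in positive degree, hence 0.\<close>
    have "(\<Sum>k\<le>n. fps_nth (?V ^ k) n) = (\<Sum>k=1..n. fps_nth (?V ^ k) n)"
      using False by (intro sum.mono_neutral_right) (auto simp: not_le)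
    then show ?thesis
      using False by (simp add: c_coeff_def pow)
  qed (simp add: c_coeff_def)
  finally show ?thesis ..
qed

lemma c_coeff_inverse_exp_q_coeff:
  assumes "0 < q"
  shows "Abs_fps (c_coeff q) * Abs_fps (exp_q_coeff q) = 1"
proof (rule fps_ext)
  fix N
  let ?E = "Abs_fps (exp_q_coeff q)"
  let ?S = "\<Sum>k\<le>N. (1 - ?E) ^ k"
  \<comment> \<open>Degree \<open>N\<close> of the product sees only coefficients up to
    \<open>N\<close>, so a finite geometric sum can replace the series; it then telescopes against
    \<open>?E\<close>.\<close>
  have "fps_nth (Abs_fps (c_coeff q) * ?E) N = fps_nth (?S * ?E) N"
    using assms by (auto simp: fps_mult_nth c_coeff_eq_sum_powers intro!: sum.cong)
  also have "?S * ?E = 1 - (1 - ?E) ^ Suc N"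
    using one_diff_power_eq[of "1 - ?E" "Suc N"] by (simp add: lessThan_Suc_atMost mult.commute)
  also have "fps_nth ((1 - ?E) ^ Suc N) N = 0"
    using assms by (intro startsby_zero_power_prefix[rule_format]) auto
  then have "fps_nth (1 - (1 - ?E) ^ Suc N) N = fps_nth 1 N"
    by simp
  finally show "fps_nth (Abs_fps (c_coeff q) * ?E) N = fps_nth 1 N" .
qed

section \<open>The Bessel series and the numbers \<open>mu\<close>\<close>

text \<open>The coefficient of \<open>(t/2)^(2k)\<close> in \<open>g(it)\<close>: the exponent
  \<open>k(k + 1/2)\<close> merges \<open>k(k + 1)\<close> with the \<open>-k/2\<close> coming from
  the factor \<open>q powr (-1/4)\<close> in the argument.\<close>

definition g3_coeff :: "real \<Rightarrow> real \<Rightarrow> nat \<Rightarrow> real" where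
  "g3_coeff q \<alpha> k = q powr (real k * (real k + 1 / 2)) * (1 - q) ^ (2 * k) /
     (qpoch (q\<^sup>2) (q\<^sup>2) k * qpoch (q powr (2 * \<alpha> + 2)) (q\<^sup>2) k)"

text \<open>The series \<open>F\<close> with \<open>g(\<i>t) = F(-t/2)\<close>; this rescaling absorbs the factors \<open>(-1/2)\<^sup>m\<close> in \<open>mu\<close>.\<close>

definition g3_fps :: "real \<Rightarrow> real \<Rightarrow> real fps" where
  "g3_fps q \<alpha> = Abs_fps (\<lambda>n. if even n then g3_coeff q \<alpha> (n div 2) else 0)"

lemma mu_eq_fps_nth:
  assumes "0 < q" "q < 1"
  shows "mu q \<alpha> m / qfact q m = (- 1 / 2) ^ m * fps_nth (g3_fps q \<alpha> * Abs_fps (c_coeff q)) m"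
proof -
  have "fps_nth (g3_fps q \<alpha> * Abs_fps (c_coeff q)) m =
      (\<Sum>i\<in>{i\<in>{0..m}. even i}. g3_coeff q \<alpha> (i div 2) * c_coeff q (m - i))"
    unfolding fps_mult_nth g3_fps_def by (auto intro!: sum.mono_neutral_cong_right split: if_splits)
  also have "\<dots> = (\<Sum>k=0..m div 2. g3_coeff q \<alpha> k * c_coeff q (m - 2 * k))"
    by (rule sum.reindex_bij_witness[of _ "\<lambda>k. 2 * k" "\<lambda>i. i div 2"]) (auto elim!: evenE)
  finally show ?thesis
    using qfact_nonzero[OF assms, of m]
    unfolding power_divide by (simp add: mu_def g3_coeff_def)
qed

text \<open>This is the product of the \<open>mu\<close> series with \<open>exp_q(-t/2)\<close>,
  read off in degree \<open>n\<close>: the powers of \<open>-1/2\<close> combine, and the series of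
  \<open>c_coeff\<close> cancels that of \<open>exp_q_coeff\<close>.\<close>

lemma mu_convolution:
  assumes "0 < q" "q < 1"
  shows "(\<Sum>i=0..n. mu q \<alpha> i / qfact q i * ((- 1 / 2) ^ (n - i) * exp_q_coeff q (n - i))) =
    (- 1 / 2) ^ n * fps_nth (g3_fps q \<alpha>) n"
proof -
  let ?HC = "g3_fps q \<alpha> * Abs_fps (c_coeff q)"
  have "(\<Sum>i=0..n. mu q \<alpha> i / qfact q i * ((- 1 / 2) ^ (n - i) * exp_q_coeff q (n - i))) =
      (\<Sum>i=0..n. (- 1 / 2) ^ n * (fps_nth ?HC i * exp_q_coeff q (n - i)))"
  proof (rule sum.cong[OF refl])
    fix i assume "i \<in> {0..n}"
    then have "(- 1 / 2 :: real) ^ n = (- 1 / 2) ^ i * (- 1 / 2) ^ (n - i)"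
      by (simp flip: power_add)
    then show "mu q \<alpha> i / qfact q i * ((- 1 / 2) ^ (n - i) * exp_q_coeff q (n - i)) =
        (- 1 / 2) ^ n * (fps_nth ?HC i * exp_q_coeff q (n - i))"
      by (simp only: mu_eq_fps_nth[OF assms] mult_ac)
  qed
  also have "\<dots> = (- 1 / 2) ^ n * fps_nth (?HC * Abs_fps (exp_q_coeff q)) n"
    by (simp add: fps_mult_nth[of ?HC] sum_distrib_left)
  also have "?HC * Abs_fps (exp_q_coeff q) = g3_fps q \<alpha>"
    using c_coeff_inverse_exp_q_coeff[OF assms(1)] by (simp add: mult.assoc)
  finally show ?thesis .
qed

text \<open>\<open>d\<close> is the product of the first, and smallest, factors of the two
  \<open>q\<close>-Pochhammer symbols; it is positive because \<alpha> > -1 makes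
  \<open>q powr (2 * \<alpha> + 2)\<close> less than 1. The bound yields a positive radius of
  convergence.\<close>

lemma g3_coeff_bound:
  assumes "0 < q" "q < 1" "\<alpha> > -1"
  defines "d \<equiv> (1 - q\<^sup>2) * (1 - q powr (2 * \<alpha> + 2))"
  shows "0 < d" "d \<le> 1" "\<bar>g3_coeff q \<alpha> k\<bar> \<le> (1 / d) ^ k"
proof -
  define a where "a = q powr (2 * \<alpha> + 2)"
  have a: "0 < a" "a < 1"
    using assms powr_less_mono'[of q 0 "2 * \<alpha> + 2"] by (auto simp: a_def)
  have q2: "0 < q\<^sup>2" "q\<^sup>2 < 1"
    using assms by (auto simp: power_less_one_iff)
  show d: "0 < d" "d \<le> 1"
    using a q2 by (auto simp: d_def a_def[symmetric] intro!: mult_le_one)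
  have D: "d ^ k \<le> qpoch (q\<^sup>2) (q\<^sup>2) k * qpoch a (q\<^sup>2) k"
    unfolding d_def a_def[symmetric] power_mult_distrib
    using a q2 by (intro mult_mono qpoch_ge) (auto intro!: order_trans[OF _ qpoch_ge])
  have num: "q powr (real k * (real k + 1 / 2)) * (1 - q) ^ (2 * k) \<le> 1"
    using assms by (intro mult_le_one powr_le1 power_le_one) auto
  have "0 \<le> qpoch (q\<^sup>2) (q\<^sup>2) k * qpoch a (q\<^sup>2) k"
    using D d by (meson order_trans zero_le_power less_imp_le)
  then have "\<bar>g3_coeff q \<alpha> k\<bar> = q powr (real k * (real k + 1 / 2)) * (1 - q) ^ (2 * k) /
      (qpoch (q\<^sup>2) (q\<^sup>2) k * qpoch a (q\<^sup>2) k)"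
    using assms by (simp add: g3_coeff_def a_def[symmetric])
  also have "\<dots> \<le> 1 / d ^ k"
    using num D d by (intro frac_le) auto
  finally show "\<bar>g3_coeff q \<alpha> k\<bar> \<le> (1 / d) ^ k"
    by (simp add: power_divide)
qed

text \<open>Sharpens \<open>g3_has_fps_expansion\<close>, which records only the constant term, to
  explicit coefficients that can be compared with \<open>mu\<close>.\<close>

lemma g3_has_fps_expansion_g3_fps:
  assumes "0 < q" "q < 1" "\<alpha> > -1"
  shows "(\<lambda>t. g3 q \<alpha> (\<i> * t)) has_fps_expansion
    Abs_fps (\<lambda>n. of_real ((- 1 / 2) ^ n * fps_nth (g3_fps q \<alpha>) n))"
proof -
  define f where "f n = (- 1 / 2) ^ n * fps_nth (g3_fps q \<alpha>) n" for n
  define d where "d = (1 - q\<^sup>2) * (1 - q powr (2 * \<alpha> + 2))"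
  note d = g3_coeff_bound[OF assms, folded d_def]
  have "(\<lambda>t. \<Sum>n. of_real (f n) * t ^ n :: complex) has_fps_expansion Abs_fps (\<lambda>n. of_real (f n))"
  proof (rule power_series_has_fps_expansion)
    show "0 < 1 / d" using d by simp
    fix n
    have "\<bar>fps_nth (g3_fps q \<alpha>) n\<bar> \<le> (1 / d) ^ (n div 2)"
      using d by (simp add: g3_fps_def)
    also have "\<dots> \<le> (1 / d) ^ n"
      using d by (intro power_increasing) auto
    finally have "\<bar>(- 1 / 2) ^ n\<bar> * \<bar>fps_nth (g3_fps q \<alpha>) n\<bar> \<le> 1 * (1 / d) ^ n"
      by (intro mult_mono) (auto simp: power_abs power_le_one)
    then show "norm (of_real (f n) :: complex) \<le> (1 / d) ^ n"
      by (simp add: f_def norm_mult norm_power)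
  qed
  moreover have "(\<Sum>n. of_real (f n) * t ^ n) = g3 q \<alpha> (\<i> * t)" for t
  proof -
    have "(\<Sum>n. of_real (f n) * t ^ n) = (\<Sum>n. of_real (f (2 * n)) * t ^ (2 * n))"
      by (rule suminf_mono_reindex[symmetric, where g = "\<lambda>n. 2 * n"])
         (auto simp: strict_mono_def f_def g3_fps_def elim!: evenE)
    also have "\<dots> = g3 q \<alpha> (\<i> * t)"
      unfolding g3_def
    proof (intro arg_cong[where f = suminf] ext)
      fix n
      define D where "D = qpoch (q\<^sup>2) (q\<^sup>2) n * qpoch (q powr (2 * \<alpha> + 2)) (q\<^sup>2) n"
      define r where "r = (1 - q) * q powr (-1 / 4)"
      have qpow: "q powr (real n * (real n + 1 / 2)) = q ^ (n * (n + 1)) * (q powr (-1 / 4)) ^ (2 * n)"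
      proof -
        have "q ^ (n * (n + 1)) * (q powr (-1 / 4)) ^ (2 * n) =
            q powr real (n * (n + 1)) * q powr ((-1 / 4) * real (2 * n))"
          using assms(1) by (subst powr_realpow) (simp_all add: powr_power mult.commute)
        also have "\<dots> = q powr (real n * (real n + 1 / 2))"
          by (simp add: algebra_simps flip: powr_add)
        finally show ?thesis ..
      qed
      have f: "f (2 * n) = q ^ (n * (n + 1)) * (r / 2) ^ (2 * n) / D"
        by (simp add: f_def g3_fps_def g3_coeff_def qpow D_def r_def power_mult_distrib power_divide)
      have "\<i> * t / 2 * of_real r = \<i> * (t * of_real (r / 2))"
        by simp
      then have "(-1) ^ n * (\<i> * t / 2 * of_real r) ^ (2 * n) =
          ((-1) ^ n * (\<i> ^ 2) ^ n) * (t * of_real (r / 2)) ^ (2 * n)"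
        by (simp only: power_mult_distrib power_mult mult.assoc)
      \<comment> \<open>The imaginary argument removes the alternating sign of the Bessel
        series.\<close>
      also have "(-1) ^ n * (\<i> ^ 2) ^ n = (1 :: complex)"
        by (simp flip: power_mult_distrib)
      finally have "(-1) ^ n * (\<i> * t / 2 * of_real r) ^ (2 * n) =
          of_real ((r / 2) ^ (2 * n)) * t ^ (2 * n)"
        by (simp only: power_mult_distrib of_real_power mult_1 mult.commute)
      then show "of_real (f (2 * n)) * t ^ (2 * n) = (-1) ^ n * of_real (q ^ (n * (n + 1))) *
          (\<i> * t / 2 * of_real ((1 - q) * q powr (-1 / 4))) ^ (2 * n) /
          of_real (qpoch (q\<^sup>2) (q\<^sup>2) n * qpoch (q powr (2 * \<alpha> + 2)) (q\<^sup>2) n)"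
        unfolding f D_def[symmetric] r_def[symmetric] by (simp add: mult_ac)
    qed
    finally show ?thesis .
  qed
  ultimately show ?thesis
    by (simp add: f_def)
qed

section \<open>From the generating function to a recurrence\<close>

lemma exp_q_has_fps_expansion_exp_q_coeff:
  assumes "0 < q" "q < 1"
  shows "(\<lambda>t. exp_q q (c * t)) has_fps_expansion Abs_fps (\<lambda>n. c ^ n * of_real (exp_q_coeff q n))"
  using exp_q_has_fps_expansion[OF assms, of c] by (simp add: exp_q_coeff_def mult.commute)

text \<open>With \<open>G\<close> the series of \<open>g(it)\<close>, both
  \<open>?M * ?E (- 1 / 2) = G\<close> and \<open>?B * G = ?E z * ?E (- 1 / 2)\<close> hold;
  cancelling the nonzero series \<open>?E (- 1 / 2)\<close> gives the claim.\<close>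

lemma bern3_fps_times_mu_fps:
  assumes "0 < q" "q < 1" "\<alpha> > -1"
  shows "Abs_fps (\<lambda>n. bern3 q \<alpha> n z / of_real (qfact q n)) *
    Abs_fps (\<lambda>n. of_real (mu q \<alpha> n / qfact q n)) = Abs_fps (\<lambda>n. z ^ n * of_real (exp_q_coeff q n))"
    (is "?B * ?M = ?E z")
proof -
  define G :: "complex fps" where
    "G = Abs_fps (\<lambda>n. of_real ((- 1 / 2) ^ n * fps_nth (g3_fps q \<alpha>) n))"
  have "fps_nth (?M * ?E (- 1 / 2)) n = fps_nth G n" for n
  proof -
    have "fps_nth (?M * ?E (- 1 / 2)) n = of_real
        (\<Sum>i=0..n. mu q \<alpha> i / qfact q i * ((- 1 / 2) ^ (n - i) * exp_q_coeff q (n - i)))"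
      by (simp add: fps_mult_nth)
    then show ?thesis
      unfolding mu_convolution[OF assms(1,2)] by (simp add: G_def)
  qed
  then have ME: "?M * ?E (- 1 / 2) = G"
    by (simp add: fps_ext)
  have g: "(\<lambda>t. g3 q \<alpha> (\<i> * t)) has_fps_expansion G"
    unfolding G_def using assms by (rule g3_has_fps_expansion_g3_fps)
  have "isCont (\<lambda>t. g3 q \<alpha> (\<i> * t)) 0"
    using g by (rule has_fps_expansion_imp_continuous)
  moreover have "g3 q \<alpha> (\<i> * 0) = 1"
    using fps_nth_fps_expansion[OF g, of 0]
    using assms(1) by (simp add: G_def g3_fps_def g3_coeff_def qpoch_def)
  \<comment> \<open>Clearing the denominator of \<open>bern3_gf\<close> is valid only where it is
    nonzero; continuity and the value 1 at 0 give this near 0.\<close>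
  ultimately have nz: "\<forall>\<^sub>F t in nhds 0. g3 q \<alpha> (\<i> * t) \<noteq> 0"
    by (intro tendsto_imp_eventually_ne[of _ 1]) (auto simp: isCont_def tendsto_nhds_iff)
  have "bern3_gf q \<alpha> z has_fps_expansion ?B"
    using is_bern3_seq_bern3[OF assms] by (rule is_bern3_seq_has_fps_expansion)
  then have "(\<lambda>t. bern3_gf q \<alpha> z t * g3 q \<alpha> (\<i> * t)) has_fps_expansion ?B * G"
    using g by (rule has_fps_expansion_mult)
  moreover have "\<forall>\<^sub>F t in nhds 0. bern3_gf q \<alpha> z t * g3 q \<alpha> (\<i> * t) =
      exp_q q (z * t) * exp_q q (- 1 / 2 * t)"
    using nz by eventually_elim (simp add: bern3_gf_def)
  ultimately have "(\<lambda>t. exp_q q (z * t) * exp_q q (- 1 / 2 * t)) has_fps_expansion ?B * G"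
    unfolding has_fps_expansion_def by (auto elim: eventually_elim2)
  moreover have "(\<lambda>t. exp_q q (z * t) * exp_q q (- 1 / 2 * t)) has_fps_expansion ?E z * ?E (- 1 / 2)"
    by (intro has_fps_expansion_mult exp_q_has_fps_expansion_exp_q_coeff assms)
  ultimately have "?B * G = ?E z * ?E (- 1 / 2)"
    by (intro fps_ext) (simp only: fps_nth_fps_expansion)
  then have "(?B * ?M) * ?E (- 1 / 2) = ?E z * ?E (- 1 / 2)"
    by (simp only: ME[symmetric] mult.assoc)
  moreover have "fps_nth (?E (- 1 / 2)) 0 \<noteq> 0"
    using assms by simp
  then have "?E (- 1 / 2) \<noteq> 0" by (metis fps_zero_nth)
  ultimately show ?thesis
    by (subst (asm) mult_cancel_right) blast
qed

lemma bern3_recurrence: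
  assumes "0 < q" "q < 1" "\<alpha> > -1"
  shows "of_real (q powr (real n * (real n - 1) / 4)) * z ^ n =
    (\<Sum>k=0..n. bern3 q \<alpha> k z * of_real (qbinom q n k * mu q \<alpha> (n - k)))"
proof -
  have nz: "(of_real (qfact q m) :: complex) \<noteq> 0" for m
    using qfact_nonzero[OF assms(1,2)] by simp
  have "of_real (q powr (real n * (real n - 1) / 4)) * z ^ n =
      of_real (qfact q n) * (z ^ n * of_real (exp_q_coeff q n))"
    using nz by (simp add: exp_q_coeff_def)
  also have "z ^ n * of_real (exp_q_coeff q n) =
      (\<Sum>k=0..n. bern3 q \<alpha> k z / of_real (qfact q k) * of_real (mu q \<alpha> (n - k) / qfact q (n - k)))"
    using arg_cong[OF bern3_fps_times_mu_fps[OF assms, of z], of "\<lambda>F. fps_nth F n"]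
    by (simp add: fps_mult_nth)
  also have "of_real (qfact q n) * \<dots> =
      (\<Sum>k=0..n. bern3 q \<alpha> k z * of_real (qbinom q n k * mu q \<alpha> (n - k)))"
    unfolding sum_distrib_left
    using assms by (intro sum.cong) (auto simp: qbinom_eq_qfact)
  finally show ?thesis .
qed

section \<open>The determinant\<close>

lemma det_upper_unitriangular_recurrence:
  fixes b a :: "nat \<Rightarrow> 'a :: comm_ring_1" and m :: "nat \<Rightarrow> nat \<Rightarrow> 'a"
  assumes unit: "\<And>k. m k k = 1"
    and upper: "\<And>k j. j < k \<Longrightarrow> m k j = 0"
    and rec: "\<And>j. j \<le> n \<Longrightarrow> a j = (\<Sum>k=0..j. b k * m k j)"
  shows "Determinant.det (Matrix.mat (n + 1) (n + 1) (\<lambda>(i, j). if i = 0 then a j else m (i - 1) j)) =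
    (-1) ^ n * b n"
proof -
  define P where "P = Matrix.mat (n + 1) (n + 1)
    (\<lambda>(i, j). if i = 0 then b j else if j = i - 1 then 1 else (0 :: 'a))"
  define M where "M = Matrix.mat (n + 1) (n + 1) (\<lambda>(i, j). m i j)"
  have carr: "P \<in> carrier_mat (n + 1) (n + 1)" "M \<in> carrier_mat (n + 1) (n + 1)"
    by (auto simp: P_def M_def)
  have "Matrix.mat (n + 1) (n + 1) (\<lambda>(i, j). if i = 0 then a j else m (i - 1) j) = P * M"
  proof (rule eq_matI)
    fix i j assume "i < dim_row (P * M)" "j < dim_col (P * M)"
    then have ij: "i < n + 1" "j < n + 1" using carr by auto
    then have "(P * M) $$ (i, j) = (\<Sum>k=0..<n + 1. P $$ (i, k) * M $$ (k, j))"
      using carr by (simp add: scalar_prod_def)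
    also have "\<dots> = (if i = 0 then a j else m (i - 1) j)"
    proof (cases "i = 0")
      case True
      have "(\<Sum>k=0..<n + 1. P $$ (i, k) * M $$ (k, j)) = (\<Sum>k=0..<n + 1. b k * m k j)"
        using True ij by (intro sum.cong) (auto simp: P_def M_def)
      \<comment> \<open>Terms with \<open>k > j\<close> lie below the diagonal of \<open>M\<close>
        and vanish.\<close>
      also have "\<dots> = (\<Sum>k=0..j. b k * m k j)"
        using ij upper by (intro sum.mono_neutral_right) auto
      finally show ?thesis using True ij rec[of j] by simp
    next
      case False
      have "(\<Sum>k=0..<n + 1. P $$ (i, k) * M $$ (k, j)) =
          (\<Sum>k=0..<n + 1. if k = i - 1 then m k j else 0)"
        using False ij by (intro sum.cong) (auto simp: P_def M_def)
      then show ?thesis using False ij by simp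
    qed
    finally show "Matrix.mat (n + 1) (n + 1) (\<lambda>(i, j). if i = 0 then a j else m (i - 1) j) $$ (i, j) =
        (P * M) $$ (i, j)"
      using ij by simp
  qed (use carr in auto)
  moreover have "Determinant.det M = 1"
  proof -
    have "upper_triangular M"
      using upper by (auto simp: M_def)
    then have "Determinant.det M = prod_list (diag_mat M)"
      using carr(2) by (rule det_upper_triangular)
    also have "diag_mat M = map (\<lambda>i. 1) [0..<n + 1]"
      unfolding diag_mat_def using unit by (intro map_cong) (auto simp: M_def)
    finally show ?thesis by (simp add: prod_list_zero_iff map_replicate_const)
  qed
  moreover have "Determinant.det P = (-1) ^ n * b n"
  proof -
    \<comment> \<open>In row \<open>i > 0\<close> of \<open>P\<close> the entry 1 sits in column
      \<open>i - 1 < n\<close>, so the last column is zero below row 0. Deleting that row and column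
      leaves the identity.\<close>
    have "Determinant.det P = (\<Sum>i<n + 1. P $$ (i, n) * cofactor P i n)"
      using carr(1) by (rule laplace_expansion_column) simp
    also have "\<dots> = P $$ (0, n) * cofactor P 0 n"
      by (subst sum.remove[of _ 0]) (auto simp: P_def intro!: sum.neutral split: if_splits)
    also have "mat_delete P 0 n = 1\<^sub>m n"
      by (rule eq_matI) (auto simp: mat_delete_def P_def)
    then have "cofactor P 0 n = (-1) ^ n"
      by (simp add: cofactor_def)
    finally show ?thesis by (simp add: P_def mult.commute)
  qed
  ultimately show ?thesis
    using det_mult[OF carr] by simp
qed

theorem theorem2p7:
  fixes q \<alpha> :: real and n :: nat and z :: complex
  assumes "0 < q" and "q < 1" and "\<alpha> > -1"
  shows "bern3 q \<alpha> n z = (-1) ^ n *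
    Determinant.det (Matrix.mat (n + 1) (n + 1) (\<lambda>(i, j).
      if i = 0 then of_real (q powr (real j * (real j - 1) / 4)) * z ^ j
      else if i - 1 \<le> j then of_real (qbinom q j (i - 1) * mu q \<alpha> (j - (i - 1)))
      else 0))"
proof -
  define m :: "nat \<Rightarrow> nat \<Rightarrow> complex" where
    "m k j = (if k \<le> j then of_real (qbinom q j k * mu q \<alpha> (j - k)) else 0)" for k j
  have "mu q \<alpha> 0 = 1"
    using assms by (simp add: mu_def qfact_def qpoch_def c_coeff_def)
  moreover have "qbinom q k k = 1" for k
    using assms qfact_nonzero[of q k] by (simp add: qbinom_eq_qfact) (simp add: qfact_def)
  ultimately have "Determinant.det (Matrix.mat (n + 1) (n + 1) (\<lambda>(i, j).
      if i = 0 then of_real (q powr (real j * (real j - 1) / 4)) * z ^ j else m (i - 1) j)) =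
      (-1) ^ n * bern3 q \<alpha> n z"
    by (intro det_upper_unitriangular_recurrence) (auto simp: m_def bern3_recurrence[OF assms])
  then show ?thesis
    \<comment> \<open>The sign \<open>(-1) ^ n\<close> from the determinant cancels the one in the
      claim.\<close>
    by (simp only: m_def) (simp flip: mult.assoc power_mult_distrib)
qed

end
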